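(* Let $\mathcal L$ be an MV-algebra and let $N$ be the Conrad filter of $\mathcal L$. If $P$ is a prime implication filter of $\mathcal L$, then either $N\subseteq P$ or $P\subseteq N$.
   Context: In an MV-algebra $(\mathcal L,\oplus,\lnot,0)$: $1=\lnot 0$, $x\otimes y=\lnot(\lnot x\oplus\lnot y)$, $x\to y=\lnot x\oplus y$, $x\le y$ iff $x\to y=1$, and $\vee,\wedge$ are the lattice operations for $\le$. An implication filter is a lattice filter (nonempty, upward closed, closed under $\wedge$; possibly all of $\mathcal L$) which is closed under powers $x^n=x\otimes\cdots\otimes x$. A prime implication filter is a proper implication filter $F$ such that $a\vee b\in F$ implies $a\in F$ or $b\in F$. An element $u\in\mathcal L$ is a counit iff $u<1$ and there exists $v<1$ with $u\vee v=1$. The Conrad filter $N$ of $\mathcal L$ is the implication filter generated by the counits (the smallest implication filter containing all counits; it may be all of $\mathcal L$). *)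

theory Defs
  imports Main
begin

class mv_algebra =
  fixes mv_plus :: "'a \<Rightarrow> 'a \<Rightarrow> 'a"  (infixl \<open>\<oplus>\<close> 65)
    and mv_neg :: "'a \<Rightarrow> 'a"  (\<open>\<sim> _\<close> [81] 80)
    and mv_zero :: 'a  (\<open>\<zero>\<close>)
  assumes mv_plus_assoc: "(x \<oplus> y) \<oplus> z = x \<oplus> (y \<oplus> z)"
    and mv_plus_comm: "x \<oplus> y = y \<oplus> x"
    and mv_plus_zero: "x \<oplus> \<zero> = x"
    and mv_neg_neg: "\<sim> (\<sim> x) = x"
    and mv_plus_one: "x \<oplus> \<sim> \<zero> = \<sim> \<zero>"
    and mv_exchange: "\<sim> (\<sim> x \<oplus> y) \<oplus> y = \<sim> (\<sim> y \<oplus> x) \<oplus> x"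
begin

definition mv_one :: 'a  (\<open>\<one>\<close>)
  where "\<one> = \<sim> \<zero>"

definition mv_times :: "'a \<Rightarrow> 'a \<Rightarrow> 'a"  (infixl \<open>\<otimes>\<close> 70)
  where "x \<otimes> y = \<sim> (\<sim> x \<oplus> \<sim> y)"

definition mv_imp :: "'a \<Rightarrow> 'a \<Rightarrow> 'a"  (infixr \<open>\<rightarrow>\<close> 60)
  where "x \<rightarrow> y = \<sim> x \<oplus> y"

definition mv_le :: "'a \<Rightarrow> 'a \<Rightarrow> bool"  (infix \<open>\<preceq>\<close> 50)
  where "x \<preceq> y \<longleftrightarrow> (x \<rightarrow> y) = \<one>"

definition mv_less :: "'a \<Rightarrow> 'a \<Rightarrow> bool"  (infix \<open>\<prec>\<close> 50)
  where "x \<prec> y \<longleftrightarrow> x \<preceq> y \<and> x \<noteq> y"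

text \<open>Join and meet are defined as least upper and greatest lower bounds; that these exist,
  so that the definite descriptions are meaningful, is shown in \<open>mv_join_eq\<close> and
  \<open>mv_meet_eq\<close> below.\<close>

definition mv_join :: "'a \<Rightarrow> 'a \<Rightarrow> 'a"  (infixl \<open>\<squnion>\<close> 65)
  where "x \<squnion> y = (THE z. x \<preceq> z \<and> y \<preceq> z \<and> (\<forall>w. x \<preceq> w \<and> y \<preceq> w \<longrightarrow> z \<preceq> w))"

definition mv_meet :: "'a \<Rightarrow> 'a \<Rightarrow> 'a"  (infixl \<open>\<sqinter>\<close> 70)
  where "x \<sqinter> y = (THE z. z \<preceq> x \<and> z \<preceq> y \<and> (\<forall>w. w \<preceq> x \<and> w \<preceq> y \<longrightarrow> w \<preceq> z))"

primrec mv_pow :: "'a \<Rightarrow> nat \<Rightarrow> 'a"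
  where
    "mv_pow x 0 = \<one>"
  | "mv_pow x (Suc n) = x \<otimes> mv_pow x n"

definition lattice_filter :: "'a set \<Rightarrow> bool"
  where "lattice_filter F \<longleftrightarrow> F \<noteq> {} \<and>
    (\<forall>x y. x \<in> F \<and> x \<preceq> y \<longrightarrow> y \<in> F) \<and>
    (\<forall>x\<in>F. \<forall>y\<in>F. x \<sqinter> y \<in> F)"

definition implication_filter :: "'a set \<Rightarrow> bool"
  where "implication_filter F \<longleftrightarrow> lattice_filter F \<and> (\<forall>x\<in>F. \<forall>n\<ge>1. mv_pow x n \<in> F)"

definition prime_implication_filter :: "'a set \<Rightarrow> bool"
  where "prime_implication_filter F \<longleftrightarrow> implication_filter F \<and> F \<noteq> UNIV \<and>
    (\<forall>a b. a \<squnion> b \<in> F \<longrightarrow> a \<in> F \<or> b \<in> F)"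

definition counit :: "'a \<Rightarrow> bool"
  where "counit u \<longleftrightarrow> u \<prec> \<one> \<and> (\<exists>v. v \<prec> \<one> \<and> u \<squnion> v = \<one>)"

definition generated_implication_filter :: "'a set \<Rightarrow> 'a set"
  where "generated_implication_filter S = \<Inter> {F. implication_filter F \<and> S \<subseteq> F}"

definition conrad_filter :: "'a set"
  where "conrad_filter = generated_implication_filter {u. counit u}"

lemma mv_le_refl: "x \<preceq> x"
  unfolding mv_le_def mv_imp_def mv_one_def
  by (metis mv_exchange mv_neg_neg mv_plus_comm mv_plus_one mv_plus_zero)

lemma mv_le_antisym: "x \<preceq> y \<Longrightarrow> y \<preceq> x \<Longrightarrow> x = y"
  unfolding mv_le_def mv_imp_def mv_one_def
  by (metis mv_exchange mv_neg_neg mv_plus_comm mv_plus_zero)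

lemma mv_le_iff: "x \<preceq> y \<longleftrightarrow> (\<exists>z. y = x \<oplus> z)"
proof
  assume "x \<preceq> y"
  then show "\<exists>z. y = x \<oplus> z"
    unfolding mv_le_def mv_imp_def mv_one_def
    by (metis mv_exchange mv_neg_neg mv_plus_comm mv_plus_zero)
next
  assume "\<exists>z. y = x \<oplus> z"
  then show "x \<preceq> y"
    using mv_le_refl[of x] unfolding mv_le_def mv_imp_def mv_one_def
    by (metis mv_plus_assoc mv_plus_comm mv_plus_one)
qed

lemma mv_le_trans: "x \<preceq> y \<Longrightarrow> y \<preceq> z \<Longrightarrow> x \<preceq> z"
  unfolding mv_le_iff by (auto simp: mv_plus_assoc)

lemma mv_plus_mono: "x \<preceq> y \<Longrightarrow> x \<oplus> z \<preceq> y \<oplus> z"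
  unfolding mv_le_iff by (metis mv_plus_assoc mv_plus_comm)

lemma mv_neg_le_iff: "\<sim> x \<preceq> \<sim> y \<longleftrightarrow> y \<preceq> x"
  unfolding mv_le_def mv_imp_def by (metis mv_neg_neg mv_plus_comm)

lemma mv_join_ub2: "y \<preceq> (x \<rightarrow> y) \<rightarrow> y"
  unfolding mv_imp_def mv_le_iff by (metis mv_plus_comm)

lemma mv_join_ub1: "x \<preceq> (x \<rightarrow> y) \<rightarrow> y"
  using mv_join_ub2 mv_exchange unfolding mv_imp_def by metis

lemma mv_join_least:
  assumes "x \<preceq> w" and "y \<preceq> w"
  shows "(x \<rightarrow> y) \<rightarrow> y \<preceq> w"
proof -
  have "w = (w \<rightarrow> y) \<rightarrow> y"
    using assms(2) mv_exchange[of w y] unfolding mv_le_def mv_imp_def mv_one_def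
    by (metis mv_neg_neg mv_plus_comm mv_plus_zero)
  moreover have "(x \<rightarrow> y) \<rightarrow> y \<preceq> (w \<rightarrow> y) \<rightarrow> y"
    unfolding mv_imp_def using assms(1) by (simp add: mv_plus_mono mv_neg_le_iff)
  ultimately show ?thesis by simp
qed

lemma mv_join_eq: "x \<squnion> y = (x \<rightarrow> y) \<rightarrow> y"
  unfolding mv_join_def
  by (rule the_equality) (use mv_join_ub1 mv_join_ub2 mv_join_least mv_le_antisym in blast)+

lemma mv_meet_eq: "x \<sqinter> y = \<sim> (\<sim> x \<squnion> \<sim> y)"
proof -
  have "\<sim> ((\<sim> x \<rightarrow> \<sim> y) \<rightarrow> \<sim> y) \<preceq> x" "\<sim> ((\<sim> x \<rightarrow> \<sim> y) \<rightarrow> \<sim> y) \<preceq> y"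
    using mv_join_ub1 mv_join_ub2 mv_neg_le_iff mv_neg_neg by metis+
  moreover have "w \<preceq> \<sim> ((\<sim> x \<rightarrow> \<sim> y) \<rightarrow> \<sim> y)" if "w \<preceq> x" "w \<preceq> y" for w
    using that mv_join_least[of "\<sim> x" "\<sim> w" "\<sim> y"] mv_neg_le_iff mv_neg_neg by metis
  ultimately show ?thesis
    unfolding mv_meet_def mv_join_eq
    by (intro the_equality) (use mv_le_antisym in blast)+
qed

sublocale mv: bounded_lattice mv_meet mv_le mv_less mv_join mv_zero mv_one
proof
  show "x \<prec> y \<longleftrightarrow> x \<preceq> y \<and> \<not> y \<preceq> x" for x y
    using mv_le_antisym mv_le_refl unfolding mv_less_def by blast
  show "x \<sqinter> y \<preceq> x" "x \<sqinter> y \<preceq> y" for x y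
    unfolding mv_meet_eq mv_join_eq
    using mv_join_ub1 mv_join_ub2 mv_neg_le_iff mv_neg_neg by metis+
  show "x \<preceq> y \<sqinter> z" if "x \<preceq> y" "x \<preceq> z" for x y z
    unfolding mv_meet_eq mv_join_eq
    using that mv_join_least[of "\<sim> y" "\<sim> x" "\<sim> z"] mv_neg_le_iff mv_neg_neg by metis
  show "\<zero> \<preceq> x" for x
    unfolding mv_le_iff by (metis mv_plus_comm mv_plus_zero)
  show "x \<preceq> \<one>" for x
    unfolding mv_le_iff mv_one_def by (metis mv_plus_one)
  show "x \<preceq> x" for x
    by (rule mv_le_refl)
  show "x \<preceq> y \<Longrightarrow> y \<preceq> z \<Longrightarrow> x \<preceq> z" for x y z
    by (rule mv_le_trans)
  show "x \<preceq> y \<Longrightarrow> y \<preceq> x \<Longrightarrow> x = y" for x y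
    by (rule mv_le_antisym)
  show "x \<preceq> x \<squnion> y" "y \<preceq> x \<squnion> y" for x y
    unfolding mv_join_eq by (rule mv_join_ub1, rule mv_join_ub2)
  show "y \<preceq> x \<Longrightarrow> z \<preceq> x \<Longrightarrow> y \<squnion> z \<preceq> x" for x y z
    unfolding mv_join_eq by (rule mv_join_least)
qed

lemma implication_filterI:
  assumes "\<one> \<in> F"
    and "\<And>x y. x \<in> F \<Longrightarrow> x \<preceq> y \<Longrightarrow> y \<in> F"
    and "\<And>x y. x \<in> F \<Longrightarrow> y \<in> F \<Longrightarrow> x \<sqinter> y \<in> F"
    and "\<And>x n. x \<in> F \<Longrightarrow> n \<ge> 1 \<Longrightarrow> mv_pow x n \<in> F"
  shows "implication_filter F"
  unfolding implication_filter_def lattice_filter_def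
proof (intro conjI allI ballI impI)
  show "F \<noteq> {}"
    using assms(1) by blast
qed (use assms(2-4) in metis)+

lemma implication_filterD:
  assumes "implication_filter F"
  shows "\<one> \<in> F"
    and "x \<in> F \<Longrightarrow> x \<preceq> y \<Longrightarrow> y \<in> F"
    and "x \<in> F \<Longrightarrow> y \<in> F \<Longrightarrow> x \<sqinter> y \<in> F"
    and "x \<in> F \<Longrightarrow> n \<ge> 1 \<Longrightarrow> mv_pow x n \<in> F"
proof -
  have F: "F \<noteq> {}" "\<forall>x y. x \<in> F \<and> x \<preceq> y \<longrightarrow> y \<in> F"
      "\<forall>x\<in>F. \<forall>y\<in>F. x \<sqinter> y \<in> F" "\<forall>x\<in>F. \<forall>n\<ge>1. mv_pow x n \<in> F"
    using assms unfolding implication_filter_def lattice_filter_def by - (elim conjE; assumption)+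
  from F(1) obtain z where "z \<in> F"
    by blast
  with F(2) show "\<one> \<in> F"
    using mv.top_greatest[of z] by metis
  show "x \<in> F \<Longrightarrow> x \<preceq> y \<Longrightarrow> y \<in> F"
    using F(2) by metis
  show "x \<in> F \<Longrightarrow> y \<in> F \<Longrightarrow> x \<sqinter> y \<in> F"
    using F(3) by metis
  show "x \<in> F \<Longrightarrow> n \<ge> 1 \<Longrightarrow> mv_pow x n \<in> F"
    using F(4) by metis
qed

lemma implication_filter_generated: "implication_filter (generated_implication_filter S)"
proof -
  have mem: "x \<in> generated_implication_filter S \<longleftrightarrow>
      (\<forall>F. implication_filter F \<and> S \<subseteq> F \<longrightarrow> x \<in> F)" for x
    by (simp add: generated_implication_filter_def)
  show ?thesis
    by (rule implication_filterI; unfold mem) (metis implication_filterD)+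
qed

end

end

theory Submission
  imports Defs
begin

text \<open>
  The argument rests on prelinearity, \<open>(x \<rightarrow> y) \<squnion> (y \<rightarrow> x) = \<one>\<close> (lemma \<open>prelinearity\<close>): for
  incomparable \<open>x\<close> and \<open>y\<close> neither joinand is \<open>\<one>\<close>, so each of the two implications witnesses that
  the other one is a counit. Hence incomparability always produces elements of the Conrad filter.

  Suppose that \<open>P\<close> does not contain the Conrad filter \<open>N\<close>. Since \<open>N\<close> is generated by counits,
  some counit \<open>u\<close> lies outside \<open>P\<close>. Take any \<open>p \<in> P\<close> and compare it with \<open>u\<close>. It cannot lie below
  \<open>u\<close>, because \<open>P\<close> is upward closed. If \<open>u \<preceq> p\<close>, then \<open>p \<in> N\<close> as \<open>u \<in> N\<close>. If the two are
  incomparable, then \<open>u \<rightarrow> p\<close> is a counit, so that \<open>u\<close> and \<open>u \<rightarrow> p\<close> both lie in \<open>N\<close>, and modus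
  ponens for implication filters gives \<open>p \<in> N\<close>.
\<close>

context mv_algebra
begin

lemma mv_times_comm: "x \<otimes> y = y \<otimes> x"
  by (simp add: mv_times_def mv_plus_comm)

lemma mv_times_mono:
  assumes "x \<preceq> x'" and "y \<preceq> y'"
  shows "x \<otimes> y \<preceq> x' \<otimes> y'"
proof -
  have mono: "a \<otimes> c \<preceq> b \<otimes> c" if "a \<preceq> b" for a b c
    using that by (simp add: mv_times_def mv_neg_le_iff mv_plus_mono)
  have "x \<otimes> y \<preceq> x' \<otimes> y" and "x' \<otimes> y \<preceq> x' \<otimes> y'"
    using assms mono mv_times_comm by metis+
  then show ?thesis
    by (rule mv_le_trans)
qed

lemma mv_imp_antimono: "x \<preceq> y \<Longrightarrow> y \<rightarrow> z \<preceq> x \<rightarrow> z"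
  by (simp add: mv_imp_def mv_neg_le_iff mv_plus_mono)

lemma mv_le_imp: "x \<preceq> y \<rightarrow> x"
  unfolding mv_imp_def mv_le_iff using mv_plus_comm by blast

lemma mv_neg_le_imp: "\<sim> x \<preceq> x \<rightarrow> y"
  unfolding mv_imp_def mv_le_iff by blast

lemma mv_times_imp_eq_meet: "x \<otimes> (x \<rightarrow> y) = x \<sqinter> y"
  unfolding mv_meet_eq mv_join_eq mv_imp_def mv_times_def
  by (metis mv_exchange mv_neg_neg mv_plus_comm)

lemma mv_imp_times_eq_join: "x \<rightarrow> x \<otimes> y = \<sim> x \<squnion> y"
  unfolding mv_join_eq mv_imp_def mv_times_def
  by (metis mv_exchange mv_neg_neg mv_plus_comm)

text \<open>
  An upper bound \<open>w\<close> of \<open>x \<rightarrow> y\<close> and \<open>y \<rightarrow> x\<close> acts as a multiplicative unit on \<open>x \<squnion> y\<close>: from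
  \<open>y \<rightarrow> x \<preceq> w\<close> follows \<open>w \<rightarrow> x \<preceq> (y \<rightarrow> x) \<rightarrow> x\<close>, which is \<open>x \<squnion> y\<close>, and so
  \<open>x = w \<otimes> (w \<rightarrow> x) \<preceq> w \<otimes> (x \<squnion> y)\<close>; symmetrically for \<open>y\<close>. As \<open>w\<close> also dominates the
  negation of \<open>x \<squnion> y\<close>, it has to be \<open>\<one>\<close>.
\<close>

lemma prelinearity: "(x \<rightarrow> y) \<squnion> (y \<rightarrow> x) = \<one>"
proof -
  define w where "w = (x \<rightarrow> y) \<squnion> (y \<rightarrow> x)"
  define m where "m = x \<squnion> y"
  have below: "a \<preceq> w \<otimes> (a \<squnion> b)" if "b \<rightarrow> a \<preceq> w" for a b
  proof -
    have "a \<preceq> w"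
      using mv_le_imp that by (rule mv_le_trans)
    then have "a = w \<otimes> (w \<rightarrow> a)"
      by (simp add: mv_times_imp_eq_meet mv.inf_absorb2)
    also have "w \<rightarrow> a \<preceq> a \<squnion> b"
      using mv_imp_antimono[OF that, of a] mv_join_eq[of b a] mv.sup_commute[of a b] by simp
    then have "w \<otimes> (w \<rightarrow> a) \<preceq> w \<otimes> (a \<squnion> b)"
      by (rule mv_times_mono[OF mv_le_refl])
    finally show ?thesis .
  qed
  have "x \<preceq> w \<otimes> m" and "y \<preceq> w \<otimes> m"
    using below[of y x] below[of x y] mv.sup_commute[of x y] by (simp_all add: w_def m_def)
  then have "m \<preceq> m \<otimes> w"
    by (simp add: m_def mv_times_comm)
  then have "\<sim> m \<squnion> w = \<one>"
    by (simp add: mv_le_def mv_imp_times_eq_join)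
  moreover have "\<sim> m \<preceq> w"
  proof -
    have "\<sim> m \<preceq> \<sim> x"
      by (simp add: m_def mv_neg_le_iff)
    also have "\<sim> x \<preceq> x \<rightarrow> y"
      by (rule mv_neg_le_imp)
    also have "x \<rightarrow> y \<preceq> w"
      by (simp add: w_def)
    finally show ?thesis .
  qed
  ultimately have "w = \<one>"
    by (simp add: mv.sup_absorb2)
  then show ?thesis
    by (simp add: w_def)
qed

lemma counit_imp_if_incomparable:
  assumes "\<not> x \<preceq> y" and "\<not> y \<preceq> x"
  shows "counit (x \<rightarrow> y)"
  using assms prelinearity[of x y] unfolding counit_def mv_le_def
  by (metis mv_less_def mv.top_greatest)

text \<open>
  Closure under powers provides closure under \<open>\<otimes>\<close>, because the square of \<open>x \<sqinter> y\<close> lies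
  below \<open>x \<otimes> y\<close>; modus ponens is then the case \<open>x \<otimes> (x \<rightarrow> y) \<preceq> y\<close>.
\<close>

lemma implication_filter_mp:
  assumes F: "implication_filter F" and "x \<in> F" and "x \<rightarrow> y \<in> F"
  shows "y \<in> F"
proof -
  define m where "m = x \<sqinter> (x \<rightarrow> y)"
  have "m \<in> F"
    using implication_filterD(3)[OF F] assms(2,3) by (simp add: m_def)
  then have "mv_pow m 2 \<in> F"
    by (intro implication_filterD(4)[OF F]) simp_all
  then have "m \<otimes> m \<in> F"
    by (simp add: numeral_2_eq_2 mv_times_def mv_one_def mv_neg_neg mv_plus_zero)
  moreover have "m \<otimes> m \<preceq> x \<otimes> (x \<rightarrow> y)"
    by (rule mv_times_mono) (simp_all add: m_def)
  then have "m \<otimes> m \<preceq> y"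
    by (simp add: mv_times_imp_eq_meet)
  ultimately show ?thesis
    using implication_filterD(2)[OF F] by blast
qed

lemma counit_in_conrad_filter: "counit u \<Longrightarrow> u \<in> conrad_filter"
  by (auto simp: conrad_filter_def generated_implication_filter_def)

lemma conrad_filter_least:
  assumes "implication_filter F" and "\<And>u. counit u \<Longrightarrow> u \<in> F"
  shows "conrad_filter \<subseteq> F"
  using assms by (auto simp: conrad_filter_def generated_implication_filter_def)

lemma implication_filter_conrad_filter: "implication_filter conrad_filter"
  unfolding conrad_filter_def by (rule implication_filter_generated)

theorem implication_filter_comparable_conrad_filter:
  assumes F: "implication_filter F"
  shows "conrad_filter \<subseteq> F \<or> F \<subseteq> conrad_filter"
proof (cases "\<forall>u. counit u \<longrightarrow> u \<in> F")
  case True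
  then show ?thesis
    using conrad_filter_least[OF F] by blast
next
  case False
  then obtain u where u: "counit u" "u \<notin> F"
    by blast
  have "p \<in> conrad_filter" if "p \<in> F" for p
  proof (cases "u \<preceq> p")
    case True
    then show ?thesis
      using implication_filterD(2)[OF implication_filter_conrad_filter]
        counit_in_conrad_filter[OF u(1)] by blast
  next
    case False
    moreover have "\<not> p \<preceq> u"
      using implication_filterD(2)[OF F that] u(2) by blast
    ultimately have "u \<rightarrow> p \<in> conrad_filter"
      by (intro counit_in_conrad_filter counit_imp_if_incomparable)
    then show ?thesis
      by (rule implication_filter_mp[OF implication_filter_conrad_filter
            counit_in_conrad_filter[OF u(1)]])
  qed
  then show ?thesis
    by blast
qed

end

theorem proposition2p6:
  fixes P :: "'a::mv_algebra set"
  assumes "prime_implication_filter P"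
  shows "conrad_filter \<subseteq> P \<or> P \<subseteq> conrad_filter"
  using assms implication_filter_comparable_conrad_filter
  unfolding prime_implication_filter_def by blast

end
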